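(* The discrete stable distribution $\mathcal{DS}(\alpha,\gamma,\delta)$, with $\alpha\in(0,2]$ and $(\gamma,\delta)$ admissible for $\alpha$, is equivalent to the compound Poisson distribution $\mathrm{Poi}\bigvee\mathrm{bSib}(\rho,\alpha)$ with rate $\lambda>0$ and shape parameter $\rho$ admissible for $\alpha$. That is, every distribution of either kind is a distribution of the other kind with the same $\alpha$, and the parameters are related as follows. If $\alpha\neq 1$, then $\delta=\lambda\rho$ and $\gamma=\lambda(\rho-1)$. If $\alpha=1$, then $\delta=\lambda$ and $\gamma=\lambda\rho$.
   Context: The probability generating function (PGF) of a random variable $X$ with values in $\mathbb{N}_0=\{0,1,2,\ldots\}$ is $G(z)=\mathbb{E}[z^X]$. Convention: $0\log0=0$. $\mathcal{DS}(\alpha,\gamma,\delta)$, for $\alpha\in(0,2]$, is the distribution on $\mathbb{N}_0$ with PGF \[ G(z)=\begin{cases}\exp\left((z-1)\delta+\gamma(1-z)^\alpha\right) & \alpha\neq 1,\\ \exp\left((z-1)\delta+\gamma(1-z)\log(1-z)\right) & \alpha=1,\end{cases} \] where $(\gamma,\delta)\in\mathbb{R}^2$ is admissible for $\alpha$, meaning: $\gamma<0$ if $\alpha\in(0,1)$, $\gamma\ge0$ if $\alpha=1$, $\gamma>0$ if $\alpha\in(1,2]$, and $\delta\ge\alpha\gamma$. The broad Sibuya distribution $\mathrm{bSib}(\rho,\alpha)$, for $\alpha\in(0,2]$, is the distribution on $\mathbb{N}=\{1,2,\ldots\}$ with PGF \[ H(z)=\begin{cases}1-\left[\rho(1-z)+(1-\rho)(1-z)^\alpha\right]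 & \alpha\neq1,\\ z+\rho(1-z)\log(1-z) & \alpha=1,\end{cases} \] where the shape parameter $\rho$ is admissible for $\alpha$, meaning: $\rho\in\left[\frac{-\alpha}{1-\alpha},1\right)$ if $\alpha\in(0,1)$, $\rho\in[0,1]$ if $\alpha=1$, $\rho\in\left(1,\frac{\alpha}{\alpha-1}\right]$ if $\alpha\in(1,2]$. Compound Poisson distribution: if $F$ is a distribution on $\mathbb{N}_0$ with PGF $H$ satisfying $H(0)=0$, then a random variable $Y$ follows the compound Poisson distribution with rate $\lambda>0$ generated by $F$, written $Y\sim\mathrm{Poi}\bigvee F$, if its PGF is $\exp\left(\lambda(H(z)-1)\right)$.
   Formalization: The case α=1, γ=δ=0 is excluded when passing from discrete stable to compound Poisson: DS(1,0,0) is the point mass at 0 (PGF 1), whereas a compound Poisson law with rate λ>0 has PGF e^{-λ}<1 at z=0. *)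

theory Defs
  imports "HOL-Probability.Probability"
begin

text \<open>Distributions on the natural numbers are of type \<^typ>\<open>nat pmf\<close>. Probability generating
  functions are taken as real functions and compared on the unit interval, endpoints included.
  There every base \<^term>\<open>1 - z\<close> below is nonnegative; at \<open>z = 1\<close> the library values
  \<open>0 powr \<alpha> = 0\<close> and \<open>ln 0 = 0\<close> agree with the conventions \<open>0 ^ \<alpha> = 0\<close> (for positive \<open>\<alpha>\<close>)
  and \<open>0 log 0 = 0\<close>.\<close>

definition pgf :: "nat pmf \<Rightarrow> real \<Rightarrow> real" where
  "pgf p z = measure_pmf.expectation p (\<lambda>n. z ^ n)"

definition has_pgf :: "nat pmf \<Rightarrow> (real \<Rightarrow> real) \<Rightarrow> bool" where
  "has_pgf p G \<longleftrightarrow> (\<forall>z\<in>{0..1}. pgf p z = G z)"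

definition ds_admissible :: "real \<Rightarrow> real \<Rightarrow> real \<Rightarrow> bool" where
  "ds_admissible \<alpha> \<gamma> \<delta> \<longleftrightarrow>
     (\<alpha> \<in> {0<..<1} \<longrightarrow> \<gamma> < 0) \<and> (\<alpha> = 1 \<longrightarrow> \<gamma> \<ge> 0) \<and> (\<alpha> \<in> {1<..2} \<longrightarrow> \<gamma> > 0) \<and>
     \<delta> \<ge> \<alpha> * \<gamma>"

definition ds_pgf :: "real \<Rightarrow> real \<Rightarrow> real \<Rightarrow> real \<Rightarrow> real" where
  "ds_pgf \<alpha> \<gamma> \<delta> z =
     (if \<alpha> \<noteq> 1 then exp ((z - 1) * \<delta> + \<gamma> * (1 - z) powr \<alpha>)
      else exp ((z - 1) * \<delta> + \<gamma> * (1 - z) * ln (1 - z)))"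

definition is_DS :: "real \<Rightarrow> real \<Rightarrow> real \<Rightarrow> nat pmf \<Rightarrow> bool" where
  "is_DS \<alpha> \<gamma> \<delta> p \<longleftrightarrow> has_pgf p (ds_pgf \<alpha> \<gamma> \<delta>)"

definition bSib_admissible :: "real \<Rightarrow> real \<Rightarrow> bool" where
  "bSib_admissible \<alpha> \<rho> \<longleftrightarrow>
     (\<alpha> \<in> {0<..<1} \<longrightarrow> \<rho> \<in> {- \<alpha> / (1 - \<alpha>)..<1}) \<and> (\<alpha> = 1 \<longrightarrow> \<rho> \<in> {0..1}) \<and>
     (\<alpha> \<in> {1<..2} \<longrightarrow> \<rho> \<in> {1<..\<alpha> / (\<alpha> - 1)})"

definition bSib_pgf :: "real \<Rightarrow> real \<Rightarrow> real \<Rightarrow> real" where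
  "bSib_pgf \<rho> \<alpha> z =
     (if \<alpha> \<noteq> 1 then 1 - (\<rho> * (1 - z) + (1 - \<rho>) * (1 - z) powr \<alpha>)
      else z + \<rho> * (1 - z) * ln (1 - z))"

definition is_bSib :: "real \<Rightarrow> real \<Rightarrow> nat pmf \<Rightarrow> bool" where
  "is_bSib \<rho> \<alpha> F \<longleftrightarrow> set_pmf F \<subseteq> {1..} \<and> has_pgf F (bSib_pgf \<rho> \<alpha>)"

definition is_compound_Poisson :: "real \<Rightarrow> nat pmf \<Rightarrow> nat pmf \<Rightarrow> bool" where
  "is_compound_Poisson rate F p \<longleftrightarrow>
     rate > 0 \<and> pgf F 0 = 0 \<and> has_pgf p (\<lambda>z. exp (rate * (pgf F z - 1)))"

text \<open>The generating distribution is quantified existentially, so a law of this kind requires an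
  actual broad Sibuya distribution with the given parameters, not just the formula for its
  generating function.\<close>

definition is_Poi_bSib :: "real \<Rightarrow> real \<Rightarrow> real \<Rightarrow> nat pmf \<Rightarrow> bool" where
  "is_Poi_bSib rate \<rho> \<alpha> p \<longleftrightarrow> (\<exists>F. is_bSib \<rho> \<alpha> F \<and> is_compound_Poisson rate F p)"

definition params_related :: "real \<Rightarrow> real \<Rightarrow> real \<Rightarrow> real \<Rightarrow> real \<Rightarrow> bool" where
  "params_related \<alpha> \<gamma> \<delta> rate \<rho> \<longleftrightarrow>
     (if \<alpha> \<noteq> 1 then \<delta> = rate * \<rho> \<and> \<gamma> = rate * (\<rho> - 1)
      else \<delta> = rate \<and> \<gamma> = rate * \<rho>)"

end

theory Submission
  imports Defs "HOL-Real_Asymp.Real_Asymp"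
begin

text \<open>Put \<open>u = 1 - z\<close>. Both families have generating functions of the form
  \<open>exp (- \<delta> u + \<gamma> u\<^sup>\<alpha>)\<close> (with \<open>u ln u\<close> in place of \<open>u\<^sup>\<alpha>\<close> when \<open>\<alpha> = 1\<close>), and the relation
  between the parameters, \<^const>\<open>params_related\<close>, is equality of the two coefficients. So there
  are three things to see.

  First, the relation identifies the two admissible parameter regions. For \<open>\<alpha> \<noteq> 1\<close> it is inverted
  by \<open>\<lambda> = \<delta> - \<gamma>\<close> and \<open>\<rho> = \<delta> / (\<delta> - \<gamma>)\<close>; here \<open>\<lambda> \<ge> (\<alpha> - 1) \<gamma> > 0\<close>, and after
  division by \<open>\<lambda>\<close> the bound \<open>\<delta> \<ge> \<alpha> \<gamma>\<close> is the non-strict bound on \<open>\<rho>\<close>, written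
  \<open>\<rho> \<ge> \<alpha> (\<rho> - 1)\<close>, while the sign of \<open>\<gamma>\<close> is that of \<open>\<rho> - 1\<close>. For
  \<open>\<alpha> = 1\<close> the inverse is \<open>\<lambda> = \<delta>\<close>, \<open>\<rho> = \<gamma> / \<delta>\<close>, which breaks down only at \<open>\<gamma> = \<delta> = 0\<close>: there the
  law is the point mass at 0, a compound Poisson law of rate 0.

  Second, a compound Poisson law needs a distribution to generate it, so the broad Sibuya formula
  must be shown to be the generating function of a probability distribution on the positive
  integers. Its Taylor coefficients at 0 come from the binomial and the logarithmic series; the
  one at index 0 vanishes, the one at index 1 is \<open>\<rho> - \<alpha> (\<rho> - 1)\<close> (or \<open>1 - \<rho>\<close> when \<open>\<alpha> = 1\<close>), and
  the sign of the remaining ones is controlled by that of \<open>\<rho> - 1\<close> (or \<open>\<rho>\<close>) and by \<open>\<alpha> \<le> 2\<close>. Being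
  nonnegative, the coefficients sum to the left limit of the function at 1, which is 1
  (\<open>bSib_exists\<close>).

  Third, the parameters are determined by the law, because the functions \<open>u\<close> and \<open>u\<^sup>\<alpha>\<close>
  (respectively \<open>u ln u\<close>) are linearly independent: comparing the exponents at the two points
  \<open>u = 1\<close> and \<open>u = 1/2\<close> suffices (\<open>exponents_determine_params\<close>).\<close>

section \<open>Probability distributions from nonnegative power series\<close>

text \<open>A converse of Abel's limit theorem, which nonnegativity makes elementary: the partial sums
  at 1 are bounded by the limit of the function, so the series converges there, and then its sum
  bounds all values to the left of 1 and hence the limit.\<close>

lemma nonneg_power_series_sums_at_1:
  fixes a :: "nat \<Rightarrow> real"
  assumes nonneg: "\<And>n. a n \<ge> 0"
    and series: "\<And>z. 0 \<le> z \<Longrightarrow> z < 1 \<Longrightarrow> (\<lambda>n. a n * z ^ n) sums G z"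
    and lim: "(G \<longlongrightarrow> L) (at_left 1)"
  shows "a sums L"
proof -
  have near_1: "eventually (\<lambda>z::real. 0 \<le> z \<and> z < 1) (at_left 1)"
    using eventually_at_left_real[of 0 "1::real"] by (auto elim!: eventually_mono)
  have partial_le: "sum a {..<n} \<le> L" for n
  proof (rule tendsto_le)
    show "((\<lambda>z. \<Sum>k<n. a k * z ^ k) \<longlongrightarrow> sum a {..<n}) (at_left 1)"
      by (auto intro!: tendsto_eq_intros sum.cong)
    show "eventually (\<lambda>z. (\<Sum>k<n. a k * z ^ k) \<le> G z) (at_left 1)"
      using near_1
    proof (eventually_elim, elim conjE)
      fix z :: real assume z: "0 \<le> z" "z < 1"
      show "(\<Sum>k<n. a k * z ^ k) \<le> G z"
        using sum_le_suminf[OF sums_summable[OF series[OF z]], of "{..<n}"]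
          sums_unique[OF series[OF z]] nonneg z by simp
    qed
  qed (use lim in auto)
  have summable: "summable a"
    using nonneg partial_le[of "Suc n" for n]
    unfolding lessThan_Suc_atMost by (rule bounded_imp_summable)
  have "suminf a \<le> L"
    using partial_le by (rule suminf_le_const[OF summable])
  moreover have "L \<le> suminf a"
  proof (rule tendsto_upperbound[OF lim])
    show "eventually (\<lambda>z. G z \<le> suminf a) (at_left 1)"
      using near_1
    proof (eventually_elim, elim conjE)
      fix z :: real assume z: "0 \<le> z" "z < 1"
      have "a n * z ^ n \<le> a n" for n
        using nonneg[of n] z by (simp add: mult_left_le power_le_one)
      then show "G z \<le> suminf a"
        using suminf_le[OF _ sums_summable[OF series[OF z]] summable]
          sums_unique[OF series[OF z]] by simp
    qed
  qed simp
  ultimately show ?thesis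
    using summable by (simp add: sums_iff)
qed

lemma pgf_sums:
  assumes "z \<in> {0..1}"
  shows "(\<lambda>n. pmf p n * z ^ n) sums pgf p z"
proof -
  have "integrable (measure_pmf p) (\<lambda>n. z ^ n)"
    using assms by (intro measure_pmf.integrable_const_bound[where B = 1])
      (auto simp: power_le_one)
  then have "integrable (count_space UNIV) (\<lambda>n. pmf p n * z ^ n)"
    unfolding measure_pmf_eq_density by (subst (asm) integrable_density) auto
  then have "(\<lambda>n. pmf p n * z ^ n) sums (\<integral>n. pmf p n * z ^ n \<partial>count_space UNIV)"
    by (rule sums_integral_count_space_nat)
  also have "(\<integral>n. pmf p n * z ^ n \<partial>count_space UNIV) = pgf p z"
    unfolding pgf_def measure_pmf_eq_density by (subst integral_density) auto
  finally show ?thesis .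
qed

lemma pmf_with_pgf_exists:
  fixes a :: "nat \<Rightarrow> real"
  assumes nonneg: "\<And>n. a n \<ge> 0"
    and series: "\<And>z. 0 \<le> z \<Longrightarrow> z < 1 \<Longrightarrow> (\<lambda>n. a n * z ^ n) sums G z"
    and lim: "(G \<longlongrightarrow> 1) (at_left 1)" and G1: "G 1 = 1"
  shows "\<exists>p. pmf p = a \<and> has_pgf p G"
proof -
  have total: "a sums 1"
    using nonneg_power_series_sums_at_1[OF nonneg series lim] .
  have "(\<integral>\<^sup>+n. ennreal (a n) \<partial>count_space UNIV) = 1"
    using suminf_ennreal_eq[OF nonneg total] by (simp add: nn_integral_count_space_nat)
  then have pmf: "pmf (embed_pmf a) = a"
    by (intro ext pmf_embed_pmf nonneg)
  have "pgf (embed_pmf a) z = G z" if "z \<in> {0..1}" for z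
  proof -
    have "(\<lambda>n. a n * z ^ n) sums G z"
      using that total G1 series[of z] by (cases "z = 1") auto
    then show ?thesis
      using pgf_sums[OF that, of "embed_pmf a"] pmf by (simp add: sums_unique2)
  qed
  then show ?thesis
    using pmf unfolding has_pgf_def by blast
qed

section \<open>The broad Sibuya distribution exists\<close>

text \<open>The Taylor coefficients of the generating function at 0. For \<open>\<alpha> \<noteq> 1\<close> and \<open>n \<ge> 2\<close> they are
  those of the binomial series in the form \<open>(-1)\<^sup>n (\<alpha> gchoose n) = pochhammer (- \<alpha>) n / n!\<close>, which
  displays their sign. The linear part \<open>1 - \<rho> (1 - z)\<close> adds \<open>\<rho>\<close> at index 1 and cancels the binomial
  series at index 0.\<close>

definition bSib_coeff :: "real \<Rightarrow> real \<Rightarrow> nat \<Rightarrow> real" where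
  "bSib_coeff \<rho> \<alpha> n =
     (if n = 0 then 0
      else if \<alpha> \<noteq> 1 then
        (if n = 1 then \<rho> else 0) + (\<rho> - 1) * pochhammer (- \<alpha>) n / fact n
      else if n = 1 then 1 - \<rho> else \<rho> / (real n * (real n - 1)))"

lemma one_minus_powr_sums:
  fixes a z :: real
  assumes "\<bar>z\<bar> < 1"
  shows "(\<lambda>n. pochhammer (- a) n / fact n * z ^ n) sums (1 - z) powr a"
proof -
  have "(a gchoose n) * (- z) ^ n = pochhammer (- a) n / fact n * z ^ n" for n
  proof -
    have "(a gchoose n) * (- z) ^ n = ((-1) ^ n * (-1) ^ n) * (pochhammer (- a) n / fact n * z ^ n)"
      by (simp add: gbinomial_pochhammer power_minus[of z])
    also have "(-1::real) ^ n * (-1) ^ n = 1"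
      by (simp flip: power_add)
    finally show ?thesis by simp
  qed
  then show ?thesis
    using gen_binomial_real[of "- z" a] assms by simp
qed

text \<open>Multiplying the logarithmic series by \<open>1 - z\<close> turns its coefficients \<open>-1/n\<close> into the
  differences \<open>1/(n-1) - 1/n\<close>.\<close>

lemma one_minus_ln_sums:
  fixes z :: real
  assumes "\<bar>z\<bar> < 1"
  shows "(\<lambda>n. (if n \<le> 1 then - real n else 1 / (real n * (real n - 1))) * z ^ n)
           sums ((1 - z) * ln (1 - z))"
proof -
  have ln: "(\<lambda>n. - (z ^ n) / real n) sums ln (1 - z)"
    using ln_series'[of "- z"] assms by simp
  have "(\<lambda>n. z * (- (z ^ n) / real n)) sums (z * ln (1 - z))"
    using ln by (rule sums_mult)
  then have "(\<lambda>n. case n of 0 \<Rightarrow> 0 | Suc m \<Rightarrow> z * (- (z ^ m) / real m)) sums (z * ln (1 - z))"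
    using sums_Suc_iff[of "\<lambda>n. case n of 0 \<Rightarrow> 0 | Suc m \<Rightarrow> z * (- (z ^ m) / real m)"] by simp
  from sums_diff[OF ln this]
  have "(\<lambda>n. - (z ^ n) / real n - (case n of 0 \<Rightarrow> 0 | Suc m \<Rightarrow> z * (- (z ^ m) / real m)))
          sums ((1 - z) * ln (1 - z))"
    by (simp add: algebra_simps)
  moreover have "- (z ^ n) / real n - (case n of 0 \<Rightarrow> 0 | Suc m \<Rightarrow> z * (- (z ^ m) / real m))
      = (if n \<le> 1 then - real n else 1 / (real n * (real n - 1))) * z ^ n" for n
    by (cases n) (simp_all add: divide_simps, simp_all add: algebra_simps)
  ultimately show ?thesis by simp
qed

lemma bSib_coeff_sums:
  assumes "0 \<le> z" "z < 1"
  shows "(\<lambda>n. bSib_coeff \<rho> \<alpha> n * z ^ n) sums bSib_pgf \<rho> \<alpha> z"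
proof (cases "\<alpha> = 1")
  case True
  have "(\<lambda>n. (if n = 1 then z ^ n else 0)
           + \<rho> * ((if n \<le> 1 then - real n else 1 / (real n * (real n - 1))) * z ^ n))
          sums (z ^ 1 + \<rho> * ((1 - z) * ln (1 - z)))"
    using assms by (intro sums_add sums_mult sums_single one_minus_ln_sums) auto
  moreover have "(if n = 1 then z ^ n else 0)
           + \<rho> * ((if n \<le> 1 then - real n else 1 / (real n * (real n - 1))) * z ^ n)
         = bSib_coeff \<rho> \<alpha> n * z ^ n" for n
    using True by (auto simp: bSib_coeff_def algebra_simps)
  ultimately show ?thesis
    using True by (simp add: bSib_pgf_def algebra_simps)
next
  case False
  have "(\<lambda>n. (if n = 0 then (1 - \<rho>) * z ^ n else 0) + (if n = 1 then \<rho> * z ^ n else 0)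
           + (\<rho> - 1) * (pochhammer (- \<alpha>) n / fact n * z ^ n))
          sums ((1 - \<rho>) * z ^ 0 + \<rho> * z ^ 1 + (\<rho> - 1) * (1 - z) powr \<alpha>)"
    using assms by (intro sums_add sums_mult sums_single one_minus_powr_sums) auto
  moreover have "(if n = 0 then (1 - \<rho>) * z ^ n else 0) + (if n = 1 then \<rho> * z ^ n else 0)
           + (\<rho> - 1) * (pochhammer (- \<alpha>) n / fact n * z ^ n)
         = bSib_coeff \<rho> \<alpha> n * z ^ n" for n
    using False by (auto simp: bSib_coeff_def algebra_simps)
  ultimately show ?thesis
    using False by (simp add: bSib_pgf_def algebra_simps)
qed

text \<open>Let \<open>\<alpha> \<noteq> 1\<close>. From index 2 on, \<open>pochhammer (- \<alpha>) n\<close> is \<open>(- \<alpha>) (1 - \<alpha>)\<close> times factors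
  \<open>k - \<alpha>\<close> with \<open>k \<ge> 2\<close>, which are nonnegative for \<open>\<alpha> \<le> 2\<close>; it is therefore zero or of the sign of
  \<open>\<alpha> - 1\<close>, which is also the sign of \<open>\<rho> - 1\<close>. At index 1 the inequality is the non-strict bound
  on \<open>\<rho>\<close>.\<close>

lemma bSib_coeff_nonneg:
  assumes \<alpha>: "0 < \<alpha>" "\<alpha> \<le> 2" and adm: "bSib_admissible \<alpha> \<rho>"
  shows "bSib_coeff \<rho> \<alpha> n \<ge> 0"
proof -
  consider "n = 0" | "n = 1" | m where "n = Suc (Suc m)"
    by (metis One_nat_def old.nat.exhaust)
  then show ?thesis
  proof cases
    case 1
    then show ?thesis by (simp add: bSib_coeff_def)
  next
    case 2
    consider "\<alpha> < 1" | "\<alpha> = 1" | "\<alpha> > 1" by linarith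
    then have "\<alpha> \<noteq> 1 \<longrightarrow> \<rho> + (1 - \<rho>) * \<alpha> \<ge> 0" "\<alpha> = 1 \<longrightarrow> \<rho> \<le> 1"
      using \<alpha> adm by (cases; simp add: bSib_admissible_def field_simps)+
    then show ?thesis
      using 2 by (auto simp: bSib_coeff_def algebra_simps)
  next
    case 3
    have factor: "(\<rho> - 1) * pochhammer (- \<alpha>) n
        = ((\<rho> - 1) * (- \<alpha> * (1 - \<alpha>))) * pochhammer (2 - \<alpha>) m"
      by (simp add: 3 pochhammer_rec algebra_simps)
    have tail: "pochhammer (2 - \<alpha>) m \<ge> 0"
      using \<alpha> by (auto simp: pochhammer_prod intro!: prod_nonneg)
    have "(\<rho> - 1) * (- \<alpha> * (1 - \<alpha>)) \<ge> 0" if "\<alpha> \<noteq> 1"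
    proof (cases "\<alpha> < 1")
      case True
      then have "(1 - \<rho>) * (\<alpha> * (1 - \<alpha>)) \<ge> 0"
        using \<alpha> adm by (intro mult_nonneg_nonneg) (auto simp: bSib_admissible_def)
      then show ?thesis by (simp add: algebra_simps)
    next
      case False
      then have "(\<rho> - 1) * (\<alpha> * (\<alpha> - 1)) \<ge> 0"
        using that \<alpha> adm by (intro mult_nonneg_nonneg) (auto simp: bSib_admissible_def)
      then show ?thesis by (simp add: algebra_simps)
    qed
    then have "\<alpha> \<noteq> 1 \<longrightarrow> (\<rho> - 1) * pochhammer (- \<alpha>) n / fact n \<ge> 0"
      unfolding factor using tail by (intro impI divide_nonneg_pos[OF mult_nonneg_nonneg] fact_gt_zero) blast+
    moreover have "\<alpha> = 1 \<longrightarrow> \<rho> \<ge> 0"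
      using adm by (auto simp: bSib_admissible_def)
    ultimately show ?thesis
      using 3 by (auto simp: bSib_coeff_def)
  qed
qed

lemma bSib_pgf_tendsto_1:
  assumes "\<alpha> > 0"
  shows "(bSib_pgf \<rho> \<alpha> \<longlongrightarrow> 1) (at_left 1)"
proof (cases "\<alpha> = 1")
  case True
  have "((\<lambda>z::real. (1 - z) * ln (1 - z)) \<longlongrightarrow> 0) (at_left 1)"
    by real_asymp
  then have "((\<lambda>z. z + \<rho> * ((1 - z) * ln (1 - z))) \<longlongrightarrow> 1 + \<rho> * 0) (at_left 1)"
    by (intro tendsto_intros)
  then show ?thesis
    using True by (simp add: bSib_pgf_def[abs_def] mult.assoc)
next
  case False
  have "((\<lambda>z::real. (1 - z) powr \<alpha>) \<longlongrightarrow> 0) (at_left 1)"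
    using assms by real_asymp
  then have "((\<lambda>z. 1 - (\<rho> * (1 - z) + (1 - \<rho>) * (1 - z) powr \<alpha>))
      \<longlongrightarrow> 1 - (\<rho> * (1 - 1) + (1 - \<rho>) * 0)) (at_left 1)"
    by (intro tendsto_intros)
  then show ?thesis
    using False by (simp add: bSib_pgf_def[abs_def])
qed

lemma bSib_exists:
  assumes "0 < \<alpha>" "\<alpha> \<le> 2" "bSib_admissible \<alpha> \<rho>"
  shows "\<exists>F. is_bSib \<rho> \<alpha> F"
proof -
  have "bSib_pgf \<rho> \<alpha> 1 = 1"
    by (simp add: bSib_pgf_def)
  then obtain F where F: "pmf F = bSib_coeff \<rho> \<alpha>" "has_pgf F (bSib_pgf \<rho> \<alpha>)"
    using pmf_with_pgf_exists[OF bSib_coeff_nonneg[OF assms] bSib_coeff_sums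
        bSib_pgf_tendsto_1[OF assms(1)]] by blast
  have "pmf F 0 = 0"
    by (simp add: F bSib_coeff_def)
  then have "set_pmf F \<subseteq> {1..}"
    by (auto simp: set_pmf_iff Suc_le_eq intro!: gr0I)
  with F show ?thesis
    by (auto simp: is_bSib_def)
qed

section \<open>Comparison of the two families\<close>

text \<open>The generating function of the compound law depends on its generator only through the
  generator's own generating function, which is prescribed; what remains of the existential
  quantifier is the existence of the broad Sibuya distribution.\<close>

lemma is_Poi_bSib_iff:
  assumes "0 < \<alpha>" "\<alpha> \<le> 2" "bSib_admissible \<alpha> \<rho>" "rate > 0"
  shows "is_Poi_bSib rate \<rho> \<alpha> p \<longleftrightarrow> has_pgf p (\<lambda>z. exp (rate * (bSib_pgf \<rho> \<alpha> z - 1)))"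
proof -
  have "is_compound_Poisson rate F p \<longleftrightarrow> has_pgf p (\<lambda>z. exp (rate * (bSib_pgf \<rho> \<alpha> z - 1)))"
    if "is_bSib \<rho> \<alpha> F" for F
  proof -
    have "\<forall>z\<in>{0..1}. pgf F z = bSib_pgf \<rho> \<alpha> z"
      using that by (simp add: is_bSib_def has_pgf_def)
    then show ?thesis
      using assms(4) by (simp add: is_compound_Poisson_def has_pgf_def) (simp add: bSib_pgf_def)
  qed
  then show ?thesis
    using bSib_exists[OF assms(1-3)] by (auto simp: is_Poi_bSib_def)
qed

lemma ds_pgf_eq_of_params_related:
  assumes "params_related \<alpha> \<gamma> \<delta> rate \<rho>"
  shows "ds_pgf \<alpha> \<gamma> \<delta> z = exp (rate * (bSib_pgf \<rho> \<alpha> z - 1))"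
  using assms
  by (auto simp: params_related_def ds_pgf_def bSib_pgf_def algebra_simps split: if_splits)

lemma is_DS_iff_is_Poi_bSib:
  assumes "0 < \<alpha>" "\<alpha> \<le> 2" "bSib_admissible \<alpha> \<rho>" "rate > 0" "params_related \<alpha> \<gamma> \<delta> rate \<rho>"
  shows "is_DS \<alpha> \<gamma> \<delta> p \<longleftrightarrow> is_Poi_bSib rate \<rho> \<alpha> p"
  using assms by (simp add: is_DS_def is_Poi_bSib_iff has_pgf_def ds_pgf_eq_of_params_related)

lemma exponents_determine_params:
  assumes eq: "\<And>z. z \<in> {0..1} \<Longrightarrow> ds_pgf \<alpha> \<gamma> \<delta> z = exp (rate * (bSib_pgf \<rho> \<alpha> z - 1))"
  shows "params_related \<alpha> \<gamma> \<delta> rate \<rho>"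
proof (cases "\<alpha> = 1")
  case True
  have "\<delta> = rate"
    using eq[of 0] True by (simp add: ds_pgf_def bSib_pgf_def)
  moreover have "\<gamma> = rate * \<rho>"
    using eq[of "1/2"] True \<open>\<delta> = rate\<close> by (simp add: ds_pgf_def bSib_pgf_def algebra_simps ln_div)
  ultimately show ?thesis
    using True by (simp add: params_related_def)
next
  case False
  \<comment> \<open>The exponents differ by \<open>A u + B u powr \<alpha>\<close>, which vanishes at \<open>u = 1\<close> and \<open>u = 1/2\<close>.\<close>
  define A B where "A = rate * \<rho> - \<delta>" and "B = \<gamma> - rate * (\<rho> - 1)"
  have "B = - A"
    using eq[of 0] False by (simp add: ds_pgf_def bSib_pgf_def A_def B_def algebra_simps)
  moreover have "A * (1/2) + B * (1/2) powr \<alpha> = 0"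
    using eq[of "1/2"] False
    by (simp add: ds_pgf_def bSib_pgf_def A_def B_def algebra_simps diff_divide_distrib)
  ultimately have "A * ((1/2) powr 1 - (1/2) powr \<alpha>) = 0"
    by (simp add: algebra_simps)
  moreover have "(1/2::real) powr 1 \<noteq> (1/2) powr \<alpha>"
    using False by (subst powr_inj) auto
  ultimately have "A = 0" "B = 0"
    using \<open>B = - A\<close> by auto
  then show ?thesis
    using False by (simp add: params_related_def A_def B_def)
qed

lemma bSib_params_of_ds_params:
  assumes \<alpha>: "0 < \<alpha>" "\<alpha> \<le> 2" and adm: "ds_admissible \<alpha> \<gamma> \<delta>"
    and nondegenerate: "\<not> (\<alpha> = 1 \<and> \<gamma> = 0 \<and> \<delta> = 0)"
  shows "\<exists>rate \<rho>. rate > 0 \<and> bSib_admissible \<alpha> \<rho> \<and> params_related \<alpha> \<gamma> \<delta> rate \<rho>"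
proof (cases "\<alpha> = 1")
  case True
  then have "0 \<le> \<gamma>" "\<gamma> \<le> \<delta>" "\<delta> > 0"
    using adm nondegenerate by (auto simp: ds_admissible_def)
  then show ?thesis
    using True
    by (intro exI[of _ \<delta>] exI[of _ "\<gamma> / \<delta>"]) (auto simp: bSib_admissible_def params_related_def)
next
  case False
  define rate \<rho> where "rate = \<delta> - \<gamma>" and "\<rho> = \<delta> / rate"
  have le: "\<alpha> * \<gamma> \<le> \<delta>"
    using adm by (simp add: ds_admissible_def)
  have "(\<alpha> - 1) * \<gamma> > 0"
    using \<alpha> False adm by (cases "\<alpha> < 1") (auto simp: ds_admissible_def zero_less_mult_iff)
  then have rate: "rate > 0"
    using le by (simp add: rate_def algebra_simps)
  have "params_related \<alpha> \<gamma> \<delta> rate \<rho>"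
    using False rate by (simp add: params_related_def \<rho>_def right_diff_distrib) (simp add: rate_def)
  moreover have "bSib_admissible \<alpha> \<rho>"
  proof (cases "\<alpha> < 1")
    case True
    have "- \<alpha> * rate \<le> \<delta> * (1 - \<alpha>)"
      using le by (simp add: rate_def algebra_simps)
    then have "- \<alpha> / (1 - \<alpha>) \<le> \<rho>"
      using True rate by (simp add: \<rho>_def divide_simps)
    moreover have "\<rho> < 1"
      using True \<alpha> adm rate by (simp add: ds_admissible_def \<rho>_def divide_simps) (simp add: rate_def)
    ultimately show ?thesis
      using True by (simp add: bSib_admissible_def)
  next
    case ge: False
    have "\<delta> * (\<alpha> - 1) \<le> \<alpha> * rate"
      using le by (simp add: rate_def algebra_simps)
    then have "\<rho> \<le> \<alpha> / (\<alpha> - 1)"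
      using ge False rate by (simp add: \<rho>_def divide_simps)
    moreover have "1 < \<rho>"
      using ge False \<alpha> adm rate
      by (simp add: ds_admissible_def \<rho>_def divide_simps) (simp add: rate_def)
    ultimately show ?thesis
      using ge False by (simp add: bSib_admissible_def)
  qed
  ultimately show ?thesis
    using rate by blast
qed

lemma ds_params_of_bSib_params:
  assumes \<alpha>: "0 < \<alpha>" "\<alpha> \<le> 2" and rate: "rate > 0" and adm: "bSib_admissible \<alpha> \<rho>"
  shows "\<exists>\<gamma> \<delta>. ds_admissible \<alpha> \<gamma> \<delta> \<and> params_related \<alpha> \<gamma> \<delta> rate \<rho>"
proof (cases "\<alpha> = 1")
  case True
  then have "0 \<le> rate * \<rho>" "rate * \<rho> \<le> rate"
    using adm rate by (auto simp: bSib_admissible_def mult_left_le)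
  then show ?thesis
    using True by (intro exI[of _ "rate * \<rho>"] exI[of _ rate])
      (simp add: ds_admissible_def params_related_def)
next
  case False
  have "\<alpha> * (\<rho> - 1) \<le> \<rho>"
    using \<alpha> False adm by (cases "\<alpha> < 1") (auto simp: bSib_admissible_def field_simps)
  then have "rate * (\<alpha> * (\<rho> - 1)) \<le> rate * \<rho>"
    using rate by simp
  then have "\<alpha> * (rate * (\<rho> - 1)) \<le> rate * \<rho>"
    by (simp add: mult.left_commute)
  moreover have "\<alpha> < 1 \<longrightarrow> rate * (\<rho> - 1) < 0" "\<alpha> > 1 \<longrightarrow> rate * (\<rho> - 1) > 0"
    using \<alpha> adm rate by (auto simp: bSib_admissible_def mult_less_0_iff)
  ultimately show ?thesis
    using False by (intro exI[of _ "rate * (\<rho> - 1)"] exI[of _ "rate * \<rho>"])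
      (auto simp: ds_admissible_def params_related_def)
qed

theorem theorem4p1:
  fixes \<alpha> :: real
  assumes "0 < \<alpha>" and "\<alpha> \<le> 2"
  shows
    "(\<forall>\<gamma> \<delta>. ds_admissible \<alpha> \<gamma> \<delta> \<and> \<not> (\<alpha> = 1 \<and> \<gamma> = 0 \<and> \<delta> = 0) \<longrightarrow>
        (\<exists>rate \<rho>. rate > 0 \<and> bSib_admissible \<alpha> \<rho> \<and> params_related \<alpha> \<gamma> \<delta> rate \<rho> \<and>
           (\<forall>p. is_DS \<alpha> \<gamma> \<delta> p \<longleftrightarrow> is_Poi_bSib rate \<rho> \<alpha> p)))
     \<and> (\<forall>rate \<rho>. rate > 0 \<and> bSib_admissible \<alpha> \<rho> \<longrightarrow>
        (\<exists>\<gamma> \<delta>. ds_admissible \<alpha> \<gamma> \<delta> \<and> params_related \<alpha> \<gamma> \<delta> rate \<rho> \<and>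
           (\<forall>p. is_Poi_bSib rate \<rho> \<alpha> p \<longleftrightarrow> is_DS \<alpha> \<gamma> \<delta> p)))
     \<and> (\<forall>\<gamma> \<delta> rate \<rho> p.
        ds_admissible \<alpha> \<gamma> \<delta> \<and> rate > 0 \<and> bSib_admissible \<alpha> \<rho> \<and>
        is_DS \<alpha> \<gamma> \<delta> p \<and> is_Poi_bSib rate \<rho> \<alpha> p \<longrightarrow> params_related \<alpha> \<gamma> \<delta> rate \<rho>)"
proof (intro conjI allI impI; (elim conjE)?)
  fix \<gamma> \<delta>
  assume "ds_admissible \<alpha> \<gamma> \<delta>" "\<not> (\<alpha> = 1 \<and> \<gamma> = 0 \<and> \<delta> = 0)"
  then show "\<exists>rate \<rho>. rate > 0 \<and> bSib_admissible \<alpha> \<rho> \<and> params_related \<alpha> \<gamma> \<delta> rate \<rho> \<and>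
      (\<forall>p. is_DS \<alpha> \<gamma> \<delta> p \<longleftrightarrow> is_Poi_bSib rate \<rho> \<alpha> p)"
    using bSib_params_of_ds_params[OF assms] is_DS_iff_is_Poi_bSib[OF assms] by blast
next
  fix rate \<rho> :: real
  assume "rate > 0" "bSib_admissible \<alpha> \<rho>"
  then show "\<exists>\<gamma> \<delta>. ds_admissible \<alpha> \<gamma> \<delta> \<and> params_related \<alpha> \<gamma> \<delta> rate \<rho> \<and>
      (\<forall>p. is_Poi_bSib rate \<rho> \<alpha> p \<longleftrightarrow> is_DS \<alpha> \<gamma> \<delta> p)"
    using ds_params_of_bSib_params[OF assms] is_DS_iff_is_Poi_bSib[OF assms] by blast
next
  fix \<gamma> \<delta> rate \<rho> :: real and p
  assume "rate > 0" "bSib_admissible \<alpha> \<rho>" and DS: "is_DS \<alpha> \<gamma> \<delta> p"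
    and Poi: "is_Poi_bSib rate \<rho> \<alpha> p"
  then have "has_pgf p (\<lambda>z. exp (rate * (bSib_pgf \<rho> \<alpha> z - 1)))"
    using is_Poi_bSib_iff[OF assms] by blast
  with DS show "params_related \<alpha> \<gamma> \<delta> rate \<rho>"
    by (intro exponents_determine_params) (auto simp: is_DS_def has_pgf_def)
qed

end
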